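(* Let $p$ be a prime number and $n\geq 1$ an integer. (a) The $f$-vector of $X(\mathbb{F}_p^n)$ is given by $f_{-1}=1$ and $$f_i(X(\mathbb{F}_p^n))=\frac{(p^n-p^{i})\cdots(p^n-p^0)}{(i+1)!}\quad\text{for } 0\leq i\leq n-1.$$ (b) The $f$-vector of $K(\mathbb{F}_p^n)$ is given by $f_{-1}=1$ and $$f_i(K(\mathbb{F}_p^n))=\frac{(p^n-p^{i})\cdots(p^n-p^0)}{(p-1)^{i+1}(i+1)!}\quad\text{for } 0\leq i\leq n-1.$$ (c) Let $\sigma$ be an $m$-simplex in $X(\mathbb{F}_p^n)$. The $f$-vector of $\mathrm{Lk}_{X(\mathbb{F}_p^n)}(\sigma)$ is given by $f_{-1}=1$ and $$f_i(\mathrm{Lk}_{X(\mathbb{F}_p^n)}(\sigma))=\frac{(p^n-p^{m+1})\cdots(p^n-p^{m+i+1})}{(i+1)!}\quad\text{for } 0\leq i\leq n-m-2.$$ (d) Let $\sigma$ be an $m$-simplex in $K(\mathbb{F}_p^n)$. The $f$-vector of $\mathrm{Lk}_{K(\mathbb{F}_p^n)}(\sigma)$ is given by $f_{-1}=1$ and $$f_i(\mathrm{Lk}_{K(\mathbb{F}_p^n)}(\sigma))=\frac{(p^n-p^{m+1})\cdots(p^n-p^{m+i+1})}{(p-1)^{i+1}(i+1)!}\quad\text{for } 0\leq i\leq n-m-2.$$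
   Context: $X(\mathbb{F}_p^n)$ is the simplicial complex whose vertices are the nonzero vectors of $\mathbb{F}_p^n$ and whose simplices are the linearly independent (unimodular) subsets of $\mathbb{F}_p^n$. $K(\mathbb{F}_p^n)$ is the simplicial complex whose vertices are the one-dimensional subspaces (lines) of $\mathbb{F}_p^n$ and whose $m$-simplices are the sets of $m+1$ lines spanning an $(m+1)$-dimensional subspace. The $f$-vector of a $d$-dimensional finite simplicial complex $K$ is $(f_{-1},f_0,\ldots,f_d)$, where $f_{-1}=1$ and $f_i=f_i(K)$ is the number of $i$-dimensional simplices (those with $i+1$ vertices). The link of $\sigma$ in $K$ is $\mathrm{Lk}_K(\sigma)=\{\tau : \sigma\cup\tau\in K,\ \sigma\cap\tau=\emptyset\}$. The products mean $\prod_{j=0}^{i}(p^n-p^j)$ and $\prod_{j=m+1}^{m+i+1}(p^n-p^j)$ respectively. *)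

theory Defs
  imports "HOL-Analysis.Cartesian_Space" "Berlekamp_Zassenhaus.Finite_Field"
begin

text \<open>
  A finite simplicial complex is represented by the set of its simplices, each simplex being the
  set of its vertices. The empty simplex, of dimension \<open>-1\<close>, is included.
\<close>

text \<open>The subtraction is over \<^typ>\<open>int\<close>, so that \<open>{{}}\<close> has dimension \<open>-1\<close>.\<close>

definition complex_dim :: "'v set set \<Rightarrow> int" where
  "complex_dim K = Max ((\<lambda>\<sigma>. int (card \<sigma>) - 1) ` K)"

definition face_number :: "'v set set \<Rightarrow> int \<Rightarrow> nat" where
  "face_number K i = card {\<sigma> \<in> K. finite \<sigma> \<and> int (card \<sigma>) - 1 = i}"

text \<open>The list \<open>[f\<^sub>-\<^sub>1, f\<^sub>0, \<dots>, f\<^sub>d]\<close> where \<open>d\<close> is the dimension of the complex.\<close>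

definition f_vector :: "'v set set \<Rightarrow> nat list" where
  "f_vector K = map (face_number K) [-1..complex_dim K]"

definition link :: "'v set set \<Rightarrow> 'v set \<Rightarrow> 'v set set" where
  "link K \<sigma> = {\<tau>. \<sigma> \<union> \<tau> \<in> K \<and> \<sigma> \<inter> \<tau> = {}}"

text \<open>
  The complexes \<open>X(k\<^sup>n)\<close> and \<open>K(k\<^sup>n)\<close>, where \<open>k\<close> is the field \<^typ>\<open>'k\<close> and
  \<open>n = CARD('n)\<close>.
\<close>

definition X_complex :: "('k::field ^ 'n) set set" where
  "X_complex = {\<sigma>. finite \<sigma> \<and> \<sigma> \<subseteq> UNIV - {0} \<and> vec.independent \<sigma>}"

definition lines :: "('k::field ^ 'n) set set" where
  "lines = {L. vec.subspace L \<and> vec.dim L = 1}"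

definition K_complex :: "('k::field ^ 'n) set set set" where
  "K_complex = {\<sigma>. finite \<sigma> \<and> \<sigma> \<subseteq> lines \<and> vec.dim (vec.span (\<Union>\<sigma>)) = card \<sigma>}"

end

theory Submission
  imports Defs
begin

text \<open>
  In both complexes the number of ways to enlarge a simplex by one vertex depends only on the number
  \<open>k\<close> of its vertices. Over a field with \<open>q\<close> elements a \<open>k\<close>-element simplex spans a subspace with
  \<open>q\<^sup>k\<close> vectors; the vectors outside it, \<open>q\<^sup>n - q\<^sup>k\<close> in number, are the admissible new vertices of
  \<open>X\<close>, and they fall into classes of \<open>q - 1\<close> nonzero multiples, one for each admissible new line, in
  the case of \<open>K\<close> (\<open>X_extension_count\<close>, \<open>K_extension_count\<close>).

  For a complex with this property, say with \<open>a k\<close> enlargements of each \<open>k\<close>-element simplex, building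
  a simplex vertex by vertex yields \<open>a 0 * \<dots> * a (k - 1)\<close> ordered simplices on \<open>k\<close> vertices, hence
  \<open>a 0 * \<dots> * a (k - 1) / k!\<close> unordered ones (\<open>fact_times_layer_card\<close>). The dimension is
  determined by the first zero of \<open>a\<close>. Finally, enlarging a simplex \<open>\<tau>\<close> in the link of \<open>\<sigma>\<close> amounts
  to enlarging \<open>\<sigma> \<union> \<tau>\<close>, so a link is again of this kind, with the sequence \<open>a\<close> shifted by
  \<open>card \<sigma>\<close> (\<open>regular_link\<close>); this reduces the statements on links to the same computation.
\<close>

section \<open>Complexes with a uniform number of one-vertex extensions\<close>

text \<open>
  The values of \<open>a\<close> lie in a field, so that the vertex numbers of \<open>K\<close> can be written as
  quotients. \<open>N\<close> is the number of vertices of the largest simplices.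
\<close>

locale regular_complex =
  fixes C :: "'v set set" and a :: "nat \<Rightarrow> 'f::field_char_0" and N :: nat
  assumes finite_vertices: "finite (\<Union>C)"
    and empty_simplex: "{} \<in> C"
    and face: "\<sigma> \<in> C \<Longrightarrow> \<tau> \<subseteq> \<sigma> \<Longrightarrow> \<tau> \<in> C"
    and extension_count:
      "\<sigma> \<in> C \<Longrightarrow> of_nat (card {v. v \<notin> \<sigma> \<and> insert v \<sigma> \<in> C}) = a (card \<sigma>)"
    and extensible: "k < N \<Longrightarrow> a k \<noteq> 0"
    and not_extensible: "a N = 0"
begin

lemma finite_complex: "finite C"
  using finite_vertices by (rule finite_UnionD)

lemma finite_simplex: "\<sigma> \<in> C \<Longrightarrow> finite \<sigma>"
  using finite_vertices by (meson Union_upper finite_subset)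

lemma finite_extensions: "finite {v. v \<notin> \<sigma> \<and> insert v \<sigma> \<in> C}"
  by (rule finite_subset[OF _ finite_vertices]) auto

text \<open>
  Both sides count the pairs of a simplex \<open>\<tau>\<close> with \<open>k + 1\<close> vertices and a vertex \<open>v\<close> of it:
  choose \<open>\<tau>\<close> first, or choose \<open>\<tau> - {v}\<close> first.
\<close>

lemma layer_recursion:
  "of_nat (Suc k) * of_nat (card {\<tau> \<in> C. card \<tau> = Suc k}) = a k * of_nat (card {\<sigma> \<in> C. card \<sigma> = k})"
proof -
  let ?P = "SIGMA \<sigma>:{\<sigma> \<in> C. card \<sigma> = k}. {v. v \<notin> \<sigma> \<and> insert v \<sigma> \<in> C}"
  let ?Q = "SIGMA \<tau>:{\<tau> \<in> C. card \<tau> = Suc k}. \<tau>"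
  have "bij_betw (\<lambda>(\<sigma>, v). (insert v \<sigma>, v)) ?P ?Q"
  proof (rule bij_betw_byWitness[where f' = "\<lambda>(\<tau>, v). (\<tau> - {v}, v)"])
    show "(\<lambda>(\<sigma>, v). (insert v \<sigma>, v)) ` ?P \<subseteq> ?Q"
      by (auto simp: finite_simplex)
    show "(\<lambda>(\<tau>, v). (\<tau> - {v}, v)) ` ?Q \<subseteq> ?P"
      by (auto simp: finite_simplex insert_absorb intro: face)
  qed (auto simp: insert_absorb)
  then have "card ?P = card ?Q"
    by (rule bij_betw_same_card)
  then have "(of_nat (card ?P) :: 'f) = of_nat (card ?Q)"
    by simp
  then show ?thesis
    by (simp add: card_SigmaI finite_complex finite_simplex finite_extensions extension_count algebra_simps)
qed

lemma fact_times_layer_card: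
  "fact k * of_nat (card {\<sigma> \<in> C. card \<sigma> = k}) = (\<Prod>j<k. a j)"
proof (induction k)
  case 0
  have "{\<sigma> \<in> C. card \<sigma> = 0} = {{}}"
    using empty_simplex finite_simplex by auto
  then show ?case by simp
next
  case (Suc k)
  have "fact (Suc k) * of_nat (card {\<sigma> \<in> C. card \<sigma> = Suc k})
      = fact k * (of_nat (Suc k) * of_nat (card {\<sigma> \<in> C. card \<sigma> = Suc k}) :: 'f)"
    by (simp only: fact_Suc of_nat_mult mult_ac)
  also have "\<dots> = (fact k * of_nat (card {\<sigma> \<in> C. card \<sigma> = k})) * a k"
    by (simp only: layer_recursion mult_ac)
  finally show ?case by (simp add: Suc.IH)
qed

lemma card_simplex_le: "\<sigma> \<in> C \<Longrightarrow> card \<sigma> \<le> N"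
proof (rule ccontr)
  assume \<sigma>: "\<sigma> \<in> C" and "\<not> card \<sigma> \<le> N"
  then have "(\<Prod>j<card \<sigma>. a j) = 0"
    using not_extensible by auto
  then have "(fact (card \<sigma>) :: 'f) * of_nat (card {\<tau> \<in> C. card \<tau> = card \<sigma>}) = 0"
    by (simp only: fact_times_layer_card)
  then have "card {\<tau> \<in> C. card \<tau> = card \<sigma>} = 0"
    by (simp del: card_0_eq)
  then show False
    using \<sigma> finite_complex by auto
qed

lemma face_number_eq: "of_nat (face_number C (int k - 1)) = (\<Prod>j<k. a j) / fact k"
proof -
  have "{\<sigma> \<in> C. finite \<sigma> \<and> int (card \<sigma>) - 1 = int k - 1} = {\<sigma> \<in> C. card \<sigma> = k}"
    using finite_simplex by auto
  then show ?thesis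
    using fact_times_layer_card[of k] by (simp add: face_number_def field_simps)
qed

lemma complex_dim_eq: "complex_dim C = int N - 1"
proof -
  have "(\<Prod>j<N. a j) \<noteq> 0"
    using extensible by simp
  then have "(fact N :: 'f) * of_nat (card {\<sigma> \<in> C. card \<sigma> = N}) \<noteq> 0"
    by (simp only: fact_times_layer_card not_False_eq_True)
  then have "card {\<sigma> \<in> C. card \<sigma> = N} \<noteq> 0"
    by (metis mult_zero_right of_nat_0)
  then obtain \<sigma> where "\<sigma> \<in> C" "card \<sigma> = N"
    by (metis (mono_tags, lifting) Collect_empty_eq card.empty)
  then show ?thesis
    unfolding complex_dim_def using card_simplex_le finite_complex
    by (intro Max_eqI) force+
qed

lemma f_vector_eq:
  "map of_nat (f_vector C) = 1 # map (\<lambda>i. (\<Prod>j=0..i. a j) / fact (i + 1)) [0..<N]"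
proof -
  have "[-1..int N - 1] = map (\<lambda>k. int k - 1) [0..<Suc N]"
    by (rule nth_equalityI) (auto simp: nth_append)
  then have "map of_nat (f_vector C) = map (\<lambda>k. (\<Prod>j<k. a j) / fact k) [0..<Suc N]"
    by (simp add: f_vector_def complex_dim_eq face_number_eq o_def del: upt_Suc)
  also have "[0..<Suc N] = 0 # map Suc [0..<N]"
    by (simp add: map_Suc_upt upt_conv_Cons del: upt_Suc)
  finally show ?thesis
    by (simp add: o_def atLeast0AtMost lessThan_Suc_atMost del: fact_Suc prod.lessThan_Suc upt_Suc)
qed

lemma regular_link:
  assumes \<sigma>: "\<sigma> \<in> C"
  shows "regular_complex (link C \<sigma>) (\<lambda>k. a (card \<sigma> + k)) (N - card \<sigma>)"
proof
  show "finite (\<Union>(link C \<sigma>))"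
    by (rule finite_subset[OF _ finite_vertices]) (auto simp: link_def)
  show "{} \<in> link C \<sigma>"
    using \<sigma> by (simp add: link_def)
  show "\<rho> \<in> link C \<sigma>" if "\<tau> \<in> link C \<sigma>" "\<rho> \<subseteq> \<tau>" for \<tau> \<rho>
    using that face[of "\<sigma> \<union> \<tau>" "\<sigma> \<union> \<rho>"] by (auto simp: link_def)
  show "of_nat (card {v. v \<notin> \<tau> \<and> insert v \<tau> \<in> link C \<sigma>}) = a (card \<sigma> + card \<tau>)"
    if \<tau>: "\<tau> \<in> link C \<sigma>" for \<tau>
  proof -
    have simplex: "\<sigma> \<union> \<tau> \<in> C" and disjoint: "\<sigma> \<inter> \<tau> = {}"
      using \<tau> by (auto simp: link_def)
    have "{v. v \<notin> \<tau> \<and> insert v \<tau> \<in> link C \<sigma>} = {v. v \<notin> \<sigma> \<union> \<tau> \<and> insert v (\<sigma> \<union> \<tau>) \<in> C}"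
      using disjoint by (auto simp: link_def)
    moreover have "card (\<sigma> \<union> \<tau>) = card \<sigma> + card \<tau>"
      using finite_simplex[OF simplex] disjoint by (simp add: card_Un_disjoint)
    ultimately show ?thesis
      using extension_count[OF simplex] by simp
  qed
  show "a (card \<sigma> + k) \<noteq> 0" if "k < N - card \<sigma>" for k
    using that extensible by simp
  show "a (card \<sigma> + (N - card \<sigma>)) = 0"
    using card_simplex_le[OF \<sigma>] not_extensible by simp
qed

lemma f_vector_link_eq:
  assumes \<sigma>: "\<sigma> \<in> C" and m: "card \<sigma> = m + 1"
  shows "map of_nat (f_vector (link C \<sigma>)) =
    1 # map (\<lambda>i. (\<Prod>j=m+1..m+i+1. a j) / fact (i + 1)) [0..<N - m - 1]"
proof -
  have "(\<Prod>j=0..i. a (m + 1 + j)) = (\<Prod>j=m+1..m+i+1. a j)" for i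
    using prod.shift_bounds_cl_nat_ivl[of a 0 "m + 1" i] by (simp only: add_ac add_0)
  then show ?thesis
    using regular_complex.f_vector_eq[OF regular_link[OF \<sigma>]] by (simp only: m diff_diff_left)
qed

end

section \<open>Subspaces and lines over a finite field\<close>

lemma card_span_independent:
  fixes B :: "('k::{field,finite} ^ 'n) set"
  assumes "vec.independent B"
  shows "card (vec.span B) = CARD('k) ^ card B"
proof -
  have "finite B" by simp
  then show ?thesis using assms
  proof (induction B rule: finite_induct)
    case empty
    then show ?case by simp
  next
    case (insert b B)
    then have b: "b \<notin> vec.span B" and B: "vec.independent B"
      by (auto simp: vec.independent_insert)
    have "inj_on (\<lambda>(c, x). c *s b + x) (UNIV \<times> vec.span B)"
    proof (rule inj_onI, clarify)
      fix c d x y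
      assume x: "x \<in> vec.span B" and y: "y \<in> vec.span B" and eq: "c *s b + x = d *s b + y"
      then have "(c - d) *s b = y - x"
        by (simp add: vec.scale_left_diff_distrib algebra_simps)
      then have "(c - d) *s b \<in> vec.span B"
        using x y by (simp add: vec.span_diff)
      \<comment> \<open>If \<open>c \<noteq> d\<close>, this scalar multiple is \<open>b\<close> itself.\<close>
      then have "inverse (c - d) *s ((c - d) *s b) \<in> vec.span B"
        by (rule vec.span_scale)
      then have "c = d"
        using b by (cases "c = d") auto
      then show "c = d \<and> x = y" using eq by simp
    qed
    moreover have "(\<lambda>(c, x). c *s b + x) ` (UNIV \<times> vec.span B) = vec.span (insert b B)"
    proof (intro equalityI subsetI)
      fix x assume "x \<in> vec.span (insert b B)"
      then obtain c where "x - c *s b \<in> vec.span B"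
        by (auto simp: vec.span_insert)
      then show "x \<in> (\<lambda>(c, x). c *s b + x) ` (UNIV \<times> vec.span B)"
        by (intro image_eqI[where x = "(c, x - c *s b)"]) auto
    next
      fix x assume "x \<in> (\<lambda>(c, x). c *s b + x) ` (UNIV \<times> vec.span B)"
      then obtain c y where "x = c *s b + y" "y \<in> vec.span B"
        by auto
      then show "x \<in> vec.span (insert b B)"
        by (auto simp: vec.span_insert intro!: exI[of _ c])
    qed
    ultimately have "card (vec.span (insert b B)) = card ((UNIV :: 'k set) \<times> vec.span B)"
      by (metis card_image)
    then show ?case
      using insert B by (simp add: card_cartesian_product)
  qed
qed

lemma card_span:
  fixes S :: "('k::{field,finite} ^ 'n) set"
  shows "card (vec.span S) = CARD('k) ^ vec.dim S"
proof -
  obtain B where "B \<subseteq> S" "vec.independent B" "S \<subseteq> vec.span B" "card B = vec.dim S"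
    using vec.basis_exists by blast
  then show ?thesis
    using card_span_independent[of B] by (metis vec.span_mono vec.span_span subset_antisym)
qed

lemma card_field_gt_1: "1 < CARD('k::{field,finite})"
proof -
  have "card {0, 1 :: 'k} \<le> CARD('k)"
    by (rule card_mono) auto
  then show ?thesis by simp
qed

lemma card_outside_span:
  fixes S :: "('k::{field,finite} ^ 'n) set"
  shows "of_nat (card (- vec.span S)) = (of_nat CARD('k) ^ CARD('n) - of_nat CARD('k) ^ vec.dim S :: rat)"
proof -
  have "card (vec.span S) + card (- vec.span S) = CARD('k ^ 'n)"
    by (metis card_Un_disjoint finite Compl_partition Compl_disjoint)
  then have "CARD('k) ^ vec.dim S + card (- vec.span S) = CARD('k) ^ CARD('n)"
    by (simp add: card_span)
  then have "(of_nat (CARD('k) ^ vec.dim S + card (- vec.span S)) :: rat) = of_nat (CARD('k) ^ CARD('n))"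
    by (simp only:)
  then show ?thesis by (simp add: algebra_simps)
qed

lemma span_singleton_in_lines: "v \<noteq> 0 \<Longrightarrow> vec.span {v} \<in> lines"
  by (simp add: lines_def)

lemma line_eq_span_singleton:
  assumes L: "L \<in> lines" and v: "v \<in> L" "v \<noteq> 0"
  shows "L = vec.span {v}"
proof -
  have "vec.subspace L" "vec.dim L = 1"
    using L by (simp_all add: lines_def)
  then have "vec.span {v} = L"
    using v vec.span_minimal[of "{v}" L] by (intro vec.subspace_dim_equal) simp_all
  then show ?thesis ..
qed

lemma lineE:
  assumes "L \<in> lines"
  obtains v where "v \<noteq> 0" "v \<in> L" "L = vec.span {v}"
proof -
  have "\<not> L \<subseteq> {0}"
    using assms vec.dim_eq_0[of L] by (simp add: lines_def del: vec.dim_eq_0)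
  then show thesis
    using that line_eq_span_singleton[OF assms] by blast
qed

lemma card_line:
  fixes L :: "('k::{field,finite} ^ 'n) set"
  assumes "L \<in> lines"
  shows "card L = CARD('k)"
proof -
  have "vec.span L = L" "vec.dim L = 1"
    using assms by (auto simp: lines_def)
  then show ?thesis using card_span[of L] by (metis power_one_right)
qed

text \<open>
  Every vector outside a subspace is nonzero, so it lies on exactly one line, and a line not contained in the subspace
  meets it in \<open>0\<close> only, hence contributes all of its nonzero vectors.
\<close>

lemma card_lines_outside_span:
  fixes S :: "('k::{field,finite} ^ 'n) set"
  shows "of_nat (card {L \<in> lines. \<not> L \<subseteq> vec.span S})
    = (of_nat CARD('k) ^ CARD('n) - of_nat CARD('k) ^ vec.dim S) / (of_nat CARD('k) - 1 :: rat)"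
proof -
  let ?\<L> = "{L \<in> lines. \<not> L \<subseteq> vec.span S}"
  have zero: "0 \<in> L" if "L \<in> lines" for L :: "('k ^ 'n) set"
    using that by (simp add: lines_def vec.subspace_0)
  have "- vec.span S = (\<Union>L\<in>?\<L>. L - {0})"
  proof (intro equalityI subsetI)
    fix v assume v: "v \<in> - vec.span S"
    then have "v \<noteq> 0" by (auto simp: vec.span_zero)
    then show "v \<in> (\<Union>L\<in>?\<L>. L - {0})"
      using v span_singleton_in_lines[of v]
      by (intro UN_I[of "vec.span {v}"]) (auto intro: vec.span_base)
  next
    fix v assume "v \<in> (\<Union>L\<in>?\<L>. L - {0})"
    then obtain L where "L \<in> lines" "\<not> L \<subseteq> vec.span S" "v \<in> L" "v \<noteq> 0" by blast
    then show "v \<in> - vec.span S"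
      using line_eq_span_singleton[of L v] vec.span_minimal[of "{v}" "vec.span S"] by auto
  qed
  moreover have "card (\<Union>L\<in>?\<L>. L - {0}) = (\<Sum>L\<in>?\<L>. card (L - {0}))"
    using line_eq_span_singleton by (intro card_UN_disjoint) (simp_all, blast)
  moreover have "card (L - {0}) = CARD('k) - 1" if "L \<in> ?\<L>" for L
    using that zero[of L] card_line[of L] by (simp add: card_Diff_singleton)
  ultimately have "card (- vec.span S) = card ?\<L> * (CARD('k) - 1)"
    by simp
  then have "of_nat (card ?\<L>) * (of_nat CARD('k) - 1 :: rat)
      = of_nat CARD('k) ^ CARD('n) - of_nat CARD('k) ^ vec.dim S"
    using card_field_gt_1[where 'k = 'k] card_outside_span[of S] by (simp add: of_nat_diff)
  moreover have "(of_nat CARD('k) - 1 :: rat) \<noteq> 0"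
    using card_field_gt_1[where 'k = 'k] by simp
  ultimately show ?thesis by (simp add: field_simps)
qed

section \<open>The complex of linearly independent sets\<close>

lemma X_complex_iff: "\<sigma> \<in> X_complex \<longleftrightarrow> vec.independent \<sigma>"
proof
  assume "vec.independent \<sigma>"
  moreover from this have "0 \<notin> \<sigma>" and "finite \<sigma>"
    using vec.dependent_zero vec.finiteI_independent by blast+
  ultimately show "\<sigma> \<in> X_complex"
    unfolding X_complex_def by blast
qed (simp add: X_complex_def)

lemma X_extension_count:
  fixes \<sigma> :: "('k::{field,finite} ^ 'n) set"
  assumes "\<sigma> \<in> X_complex"
  shows "of_nat (card {v. v \<notin> \<sigma> \<and> insert v \<sigma> \<in> X_complex})
    = (of_nat CARD('k) ^ CARD('n) - of_nat CARD('k) ^ card \<sigma> :: rat)"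
proof -
  have "{v. v \<notin> \<sigma> \<and> insert v \<sigma> \<in> X_complex} = - vec.span \<sigma>"
    using assms by (auto simp: X_complex_iff vec.independent_insert vec.span_base)
  then show ?thesis
    using assms card_outside_span[of \<sigma>]
    by (simp add: X_complex_iff vec.dim_eq_card_independent)
qed

lemma regular_X_complex:
  "regular_complex (X_complex :: ('k::{field,finite} ^ 'n) set set)
    (\<lambda>k. of_nat CARD('k) ^ CARD('n) - of_nat CARD('k) ^ k :: rat) CARD('n)"
proof
  show "\<tau> \<in> X_complex" if "\<sigma> \<in> X_complex" "\<tau> \<subseteq> \<sigma>" for \<sigma> \<tau> :: "('k ^ 'n) set"
    using that vec.independent_mono unfolding X_complex_iff by blast
  show "of_nat CARD('k) ^ CARD('n) - of_nat CARD('k) ^ k \<noteq> (0 :: rat)" if "k < CARD('n)" for k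
    using power_strict_increasing[OF that, of "of_nat CARD('k) :: rat"]
      card_field_gt_1[where 'k = 'k] by simp
qed (simp_all add: X_extension_count, simp add: X_complex_iff vec.independent_empty)

section \<open>The complex of independent lines\<close>

text \<open>
  Each line adds at most one dimension. Taking for \<open>A\<close> the union of a subset \<open>\<tau>\<close> of a simplex \<open>\<sigma>\<close>,
  and for the lines those of \<open>\<sigma> - \<tau>\<close>, the bound forces \<open>\<tau>\<close> to span at least \<open>card \<tau>\<close>
  dimensions, since \<open>\<sigma>\<close> spans \<open>card \<sigma>\<close>; this is why \<open>K\<close> is closed under faces.
\<close>

lemma dim_Un_lines_le:
  fixes \<sigma> :: "('k::field ^ 'n) set set"
  assumes "finite \<sigma>" "\<sigma> \<subseteq> lines"
  shows "vec.dim (A \<union> \<Union>\<sigma>) \<le> vec.dim A + card \<sigma>"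
  using assms
proof (induction \<sigma> rule: finite_induct)
  case empty
  then show ?case by simp
next
  case (insert L \<sigma>)
  then obtain v where v: "L = vec.span {v}"
    by (auto elim: lineE)
  have "A \<union> \<Union>(insert L \<sigma>) \<subseteq> vec.span (insert v (A \<union> \<Union>\<sigma>))"
    using vec.span_mono[of "{v}" "insert v (A \<union> \<Union>\<sigma>)"] v by (auto intro: vec.span_base)
  then have "vec.dim (A \<union> \<Union>(insert L \<sigma>)) \<le> vec.dim (insert v (A \<union> \<Union>\<sigma>))"
    by (rule vec.dim_mono)
  also have "\<dots> \<le> vec.dim (A \<union> \<Union>\<sigma>) + 1"
    by (simp add: vec.dim_insert)
  finally show ?case
    using insert by simp
qed

lemma K_complex_face:
  assumes \<sigma>: "\<sigma> \<in> K_complex" and "\<tau> \<subseteq> \<sigma>"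
  shows "\<tau> \<in> K_complex"
proof -
  have lines: "\<sigma> \<subseteq> lines" and dim: "vec.dim (\<Union>\<sigma>) = card \<sigma>"
    using \<sigma> by (simp_all add: K_complex_def)
  have fin: "finite \<sigma>" "finite \<tau>"
    using \<sigma> \<open>\<tau> \<subseteq> \<sigma>\<close> finite_subset[of \<tau> \<sigma>] by (simp_all add: K_complex_def)
  have "\<Union>\<sigma> = \<Union>\<tau> \<union> \<Union>(\<sigma> - \<tau>)"
    using \<open>\<tau> \<subseteq> \<sigma>\<close> by blast
  moreover have "finite (\<sigma> - \<tau>)" "\<sigma> - \<tau> \<subseteq> lines"
    using fin lines by auto
  ultimately have "vec.dim (\<Union>\<sigma>) \<le> vec.dim (\<Union>\<tau>) + card (\<sigma> - \<tau>)"
    using dim_Un_lines_le by metis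
  then have "card \<tau> \<le> vec.dim (\<Union>\<tau>)"
    using dim fin \<open>\<tau> \<subseteq> \<sigma>\<close> card_mono[OF fin(1) \<open>\<tau> \<subseteq> \<sigma>\<close>] by (simp add: card_Diff_subset)
  moreover have "vec.dim (\<Union>\<tau>) \<le> card \<tau>"
    using dim_Un_lines_le[of \<tau> "{}"] subset_trans[OF \<open>\<tau> \<subseteq> \<sigma>\<close> lines] fin by simp
  ultimately show ?thesis
    using fin subset_trans[OF \<open>\<tau> \<subseteq> \<sigma>\<close> lines] by (simp add: K_complex_def)
qed

text \<open>
  The sum of the lines in a simplex has dimension the number of lines, so a further line must raise
  the dimension by one, which it does exactly when one (hence any) of its generators is not in the
  span. A line of \<open>\<sigma>\<close> itself is excluded on both sides.
\<close>

lemma insert_in_K_complex_iff: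
  fixes \<sigma> :: "('k::field ^ 'n) set set"
  assumes \<sigma>: "\<sigma> \<in> K_complex"
  shows "L \<notin> \<sigma> \<and> insert L \<sigma> \<in> K_complex \<longleftrightarrow> L \<in> lines \<and> \<not> L \<subseteq> vec.span (\<Union>\<sigma>)"
proof (cases "L \<in> lines")
  case True
  then obtain v where v: "v \<in> L" "L = vec.span {v}"
    by (auto elim: lineE)
  have "L \<union> \<Union>\<sigma> \<subseteq> vec.span (insert v (\<Union>\<sigma>))"
    using vec.span_mono[of "{v}" "insert v (\<Union>\<sigma>)"] v by (auto intro: vec.span_base)
  moreover have "insert v (\<Union>\<sigma>) \<subseteq> vec.span (L \<union> \<Union>\<sigma>)"
    using v(1) by (auto intro: vec.span_base)
  ultimately have "vec.dim (L \<union> \<Union>\<sigma>) = vec.dim (insert v (\<Union>\<sigma>))"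
    by (metis vec.dim_span vec.span_eq)
  also have "\<dots> = (if v \<in> vec.span (\<Union>\<sigma>) then card \<sigma> else card \<sigma> + 1)"
    using \<sigma> by (simp add: vec.dim_insert K_complex_def)
  also have "v \<in> vec.span (\<Union>\<sigma>) \<longleftrightarrow> L \<subseteq> vec.span (\<Union>\<sigma>)"
    using v vec.span_minimal[of "{v}" "vec.span (\<Union>\<sigma>)"] by auto
  finally have dim: "vec.dim (L \<union> \<Union>\<sigma>)
      = (if L \<subseteq> vec.span (\<Union>\<sigma>) then card \<sigma> else card \<sigma> + 1)" .
  have member: "L \<subseteq> vec.span (\<Union>\<sigma>)" if "L \<in> \<sigma>"
    using that vec.span_superset[of "\<Union>\<sigma>"] by blast
  have "finite \<sigma>" "\<sigma> \<subseteq> lines"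
    using \<sigma> by (simp_all add: K_complex_def)
  then have "insert L \<sigma> \<in> K_complex \<longleftrightarrow> \<not> L \<subseteq> vec.span (\<Union>\<sigma>)" if "L \<notin> \<sigma>"
    using that True dim by (simp add: K_complex_def)
  then show ?thesis
    using True member by blast
qed (simp add: K_complex_def)

lemma K_extension_count:
  fixes \<sigma> :: "('k::{field,finite} ^ 'n) set set"
  assumes "\<sigma> \<in> K_complex"
  shows "of_nat (card {L. L \<notin> \<sigma> \<and> insert L \<sigma> \<in> K_complex})
    = (of_nat CARD('k) ^ CARD('n) - of_nat CARD('k) ^ card \<sigma>) / (of_nat CARD('k) - 1 :: rat)"
  using assms card_lines_outside_span[of "\<Union>\<sigma>"]
  by (simp add: insert_in_K_complex_iff) (simp add: K_complex_def)

lemma regular_K_complex: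
  "regular_complex (K_complex :: ('k::{field,finite} ^ 'n) set set set)
    (\<lambda>k. (of_nat CARD('k) ^ CARD('n) - of_nat CARD('k) ^ k) / (of_nat CARD('k) - 1) :: rat) CARD('n)"
proof
  show "\<tau> \<in> K_complex" if "\<sigma> \<in> K_complex" "\<tau> \<subseteq> \<sigma>" for \<sigma> \<tau> :: "('k ^ 'n) set set"
    using that by (rule K_complex_face)
  show "(of_nat CARD('k) ^ CARD('n) - of_nat CARD('k) ^ k) / (of_nat CARD('k) - 1) \<noteq> (0 :: rat)"
    if "k < CARD('n)" for k
    using power_strict_increasing[OF that, of "of_nat CARD('k) :: rat"]
      card_field_gt_1[where 'k = 'k] by simp
qed (simp_all add: K_extension_count, simp add: K_complex_def)

section \<open>The face numbers\<close>

theorem lemma3p2: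
  fixes p n :: nat
  assumes p: "p = CARD('p::prime_card)" and n: "n = CARD('n::finite)"
  shows
   "map of_nat (f_vector (X_complex :: ('p mod_ring ^ 'n) set set)) =
      (1::rat) # map (\<lambda>i. (\<Prod>j=0..i. of_nat p ^ n - of_nat p ^ j) / fact (i + 1)) [0..<n]
    \<and>
    map of_nat (f_vector (K_complex :: ('p mod_ring ^ 'n) set set set)) =
      (1::rat) # map (\<lambda>i. (\<Prod>j=0..i. of_nat p ^ n - of_nat p ^ j) /
                          ((of_nat p - 1) ^ (i + 1) * fact (i + 1))) [0..<n]
    \<and>
    (\<forall>(m::nat) (\<sigma> :: ('p mod_ring ^ 'n) set). \<sigma> \<in> X_complex \<and> card \<sigma> = m + 1 \<longrightarrow>
      map of_nat (f_vector (link X_complex \<sigma>)) =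
        (1::rat) # map (\<lambda>i. (\<Prod>j=m+1..m+i+1. of_nat p ^ n - of_nat p ^ j) / fact (i + 1))
                     [0..<n - m - 1])
    \<and>
    (\<forall>(m::nat) (\<sigma> :: ('p mod_ring ^ 'n) set set). \<sigma> \<in> K_complex \<and> card \<sigma> = m + 1 \<longrightarrow>
      map of_nat (f_vector (link K_complex \<sigma>)) =
        (1::rat) # map (\<lambda>i. (\<Prod>j=m+1..m+i+1. of_nat p ^ n - of_nat p ^ j) /
                            ((of_nat p - 1) ^ (i + 1) * fact (i + 1)))
                     [0..<n - m - 1])"
proof (intro conjI allI impI)
  have q: "p = CARD('p mod_ring)"
    using p by simp
  note X = regular_X_complex[where 'k = "'p mod_ring" and 'n = 'n, folded q n]
  note K = regular_K_complex[where 'k = "'p mod_ring" and 'n = 'n, folded q n]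
  show "map of_nat (f_vector (X_complex :: ('p mod_ring ^ 'n) set set)) =
      (1::rat) # map (\<lambda>i. (\<Prod>j=0..i. of_nat p ^ n - of_nat p ^ j) / fact (i + 1)) [0..<n]"
    by (rule regular_complex.f_vector_eq[OF X])
  show "map of_nat (f_vector (K_complex :: ('p mod_ring ^ 'n) set set set)) =
      (1::rat) # map (\<lambda>i. (\<Prod>j=0..i. of_nat p ^ n - of_nat p ^ j) /
                          ((of_nat p - 1) ^ (i + 1) * fact (i + 1))) [0..<n]"
    using regular_complex.f_vector_eq[OF K] by (simp add: prod_dividef del: fact_Suc)
  fix m :: nat
  show "map of_nat (f_vector (link X_complex \<sigma>)) =
      (1::rat) # map (\<lambda>i. (\<Prod>j=m+1..m+i+1. of_nat p ^ n - of_nat p ^ j) / fact (i + 1))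
                   [0..<n - m - 1]"
    if "\<sigma> \<in> X_complex \<and> card \<sigma> = m + 1" for \<sigma> :: "('p mod_ring ^ 'n) set"
    using that by (intro regular_complex.f_vector_link_eq[OF X]) simp_all
  show "map of_nat (f_vector (link K_complex \<sigma>)) =
      (1::rat) # map (\<lambda>i. (\<Prod>j=m+1..m+i+1. of_nat p ^ n - of_nat p ^ j) /
                          ((of_nat p - 1) ^ (i + 1) * fact (i + 1)))
                   [0..<n - m - 1]"
    if "\<sigma> \<in> K_complex \<and> card \<sigma> = m + 1" for \<sigma> :: "('p mod_ring ^ 'n) set set"
    using that regular_complex.f_vector_link_eq[OF K, of \<sigma> m]
    by (simp add: prod_dividef del: fact_Suc prod.cl_ivl_Suc)
qed

end
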